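(* Let $A,Q\in\mathbb{R}^{n\times n}$ with $Q=Q^{T}\ge0$, let $A$ be unmixed, and let $X$ be the unique solution of $X=A^{T}XA+Q$. Then $\ker X$ is the unobservable subspace of the pair $(A,Q)$.
   Context: $A$ is unmixed if $\lambda_1\lambda_2\neq1$ for all pairs $\lambda_1,\lambda_2\in\sigma(A)$ (including $\lambda_1=\lambda_2$), where $\sigma(A)\subset\mathbb{C}$ is the spectrum of $A$; the equation $X=A^{T}XA+Q$ has a unique solution if and only if $A$ is unmixed. The unobservable subspace of $(A,Q)$ is $\bigcap_{k\ge0}\ker(QA^{k})$, the largest $A$-invariant subspace contained in $\ker Q$. *)

theory Defs
  imports "Jordan_Normal_Form.Spectral_Radius" "Jordan_Normal_Form.Matrix_Kernel"
begin

text \<open>The spectrum of a real matrix is that of the same matrix read over the complex numbers;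
  the two eigenvalues may coincide.\<close>

definition unmixed :: "real mat \<Rightarrow> bool" where
  "unmixed A \<longleftrightarrow>
    (\<forall>\<mu> \<in> spectrum (map_mat complex_of_real A).
     \<forall>\<nu> \<in> spectrum (map_mat complex_of_real A). \<mu> * \<nu> \<noteq> 1)"

definition psd_mat :: "real mat \<Rightarrow> bool" where
  "psd_mat Q \<longleftrightarrow> square_mat Q \<and> transpose_mat Q = Q \<and>
    (\<forall>v \<in> carrier_vec (dim_row Q). 0 \<le> v \<bullet> (Q *\<^sub>v v))"

definition unobservable_subspace :: "real mat \<Rightarrow> real mat \<Rightarrow> real vec set" where
  "unobservable_subspace A Q = (\<Inter>k::nat. mat_kernel (Q * (A ^\<^sub>m k)))"

end

theory Submission
  imports Defs
begin

text \<open>If \<open>v = (A + I) w\<close> lies in \<open>ker X\<close> then \<open>X A w = - X w\<close>. Substituting this in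
  \<open>w\<^sup>T X w = (A w)\<^sup>T X (A w) + w\<^sup>T Q w\<close> and using the symmetry of \<open>X\<close> leaves \<open>w\<^sup>T Q w = 0\<close>,
  so \<open>Q w = 0\<close>; then the equation reads \<open>(A\<^sup>T + I) X w = 0\<close>, and \<open>X w = 0\<close> because \<open>-1\<close> is not
  an eigenvalue of an unmixed \<open>A\<close>. Hence \<open>(A + I)\<^sup>-\<^sup>1\<close> maps \<open>ker X\<close> into \<open>ker X \<inter> ker Q\<close>; being
  injective on a finite-dimensional space it maps \<open>ker X\<close> onto itself, so \<open>ker X\<close> is
  \<open>A\<close>-invariant and contained in \<open>ker Q\<close>. This is the usual argument for the Lyapunov equation,
  transported by the Cayley transform.

  Conversely, \<open>Y = A\<^sup>T Y A\<close> on an \<open>A\<close>-invariant complex subspace forces \<open>Y = 0\<close> there: going up a chain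
  of vectors \<open>w, (A - \<mu>) w, \<dots>, 0\<close> with eigenvalues \<open>\<mu>\<close>, from \<open>Y (A - \<mu>) w = 0\<close> one gets
  \<open>Y w = \<mu> A\<^sup>T Y w\<close>, and \<open>Y w \<noteq> 0\<close> would make \<open>1/\<mu>\<close> an eigenvalue of \<open>A\<close>. The same fact
  gives the symmetry of \<open>X\<close>.\<close>

section \<open>Induction along chains of generalized eigenvectors\<close>

text \<open>In Schur coordinates, subtracting the \<open>k\<close>-th diagonal entry sends the span of the first
  \<open>k + 1\<close> basis vectors into that of the first \<open>k\<close>.\<close>

lemma mult_mat_zero_vec: "M \<in> carrier_mat m n \<Longrightarrow> M *\<^sub>v 0\<^sub>v n = 0\<^sub>v m"
  for M :: "'a :: semiring_0 mat"
  by (intro eq_vecI) auto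

lemma eigenvalue_chain_induct [consumes 3, case_names step zero pull]:
  fixes B :: "complex mat"
  assumes B: "B \<in> carrier_mat n n" and S: "S \<subseteq> carrier_vec n" and "w \<in> S"
    and step: "\<And>w \<mu>. w \<in> S \<Longrightarrow> eigenvalue B \<mu> \<Longrightarrow> B *\<^sub>v w - \<mu> \<cdot>\<^sub>v w \<in> S"
    and zero: "P (0\<^sub>v n)"
    and pull: "\<And>w \<mu>. w \<in> S \<Longrightarrow> eigenvalue B \<mu> \<Longrightarrow> P (B *\<^sub>v w - \<mu> \<cdot>\<^sub>v w) \<Longrightarrow> P w"
  shows "P w"
proof -
  \<comment> \<open>Over the complex numbers the characteristic polynomial splits, so
    \<open>es\<close> lists all eigenvalues of \<open>B\<close> with multiplicity.\<close>
  obtain es where es: "char_poly B = (\<Prod>a\<leftarrow>es. [:- a, 1:])"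
    using char_poly_factorized[OF B] by auto
  obtain T U V where schur: "schur_decomposition B es = (T, U, V)"
    by (cases "schur_decomposition B es")
  from schur_decomposition[OF B es schur]
  have sim: "similar_mat_wit B T U V" and tri: "upper_triangular T" and diag: "diag_mat T = es"
    by auto
  note wit = similar_mat_witD2[OF B sim]
  note T = wit(5) and U = wit(6) and V = wit(7)
  have ev: "eigenvalue B (T $$ (k,k))" if "k < n" for k
  proof -
    have "T $$ (k,k) \<in> set es"
      using that T unfolding diag[symmetric] diag_mat_def by auto
    then show ?thesis
      unfolding eigenvalue_root_char_poly[OF B] es poly_prod_list prod_list_zero_iff by force
  qed
  have VB: "V *\<^sub>v (B *\<^sub>v x) = T *\<^sub>v (V *\<^sub>v x)" if x: "x \<in> carrier_vec n" for x
  proof -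
    have "V * B = V * (U * (T * V))"
      unfolding wit(3) using T U V by (simp add: assoc_mult_mat[of _ n n _ n _ n])
    also have "\<dots> = (V * U) * (T * V)"
      using T U V by (simp add: assoc_mult_mat[of _ n n _ n _ n])
    also have "\<dots> = T * V"
      unfolding wit(2) using T V by simp
    finally have "(V * B) *\<^sub>v x = (T * V) *\<^sub>v x" by simp
    then show ?thesis using T V B x by simp
  qed
  \<comment> \<open>\<open>k\<close> bounds the support of \<open>V *\<^sub>v x\<close>: for
    \<open>k = 0\<close> the vector is zero because \<open>V\<close> is invertible, and
    \<open>k = n\<close> covers all of \<open>S\<close>.\<close>
  have "P x" if "k \<le> n" "x \<in> S" "\<forall>i<n. k \<le> i \<longrightarrow> (V *\<^sub>v x) $ i = 0" for k x
    using that
  proof (induction k arbitrary: x)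
    case 0
    have x: "x \<in> carrier_vec n" using 0 S by auto
    have "V *\<^sub>v x = 0\<^sub>v n" using 0 V by (intro eq_vecI) auto
    then have "U *\<^sub>v (V *\<^sub>v x) = 0\<^sub>v n" using U by (simp add: mult_mat_zero_vec)
    moreover have "U *\<^sub>v (V *\<^sub>v x) = (U * V) *\<^sub>v x" using U V x by simp
    ultimately have "x = 0\<^sub>v n" using wit(1) x by simp
    then show ?case using zero by simp
  next
    case (Suc k)
    have x: "x \<in> carrier_vec n" using Suc.prems S by auto
    define y where "y = V *\<^sub>v x"
    have y: "y \<in> carrier_vec n" using V x unfolding y_def by simp
    define \<mu> where "\<mu> = T $$ (k,k)"
    have \<mu>: "eigenvalue B \<mu>" unfolding \<mu>_def using ev Suc.prems by simp
    have Vx': "V *\<^sub>v (B *\<^sub>v x - \<mu> \<cdot>\<^sub>v x) = T *\<^sub>v y - \<mu> \<cdot>\<^sub>v y"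
      using V B x by (simp add: mult_minus_distrib_mat_vec[of _ n n] mult_mat_vec[of _ n n] VB y_def)
    have "(T *\<^sub>v y - \<mu> \<cdot>\<^sub>v y) $ i = 0" if i: "i < n" "k \<le> i" for i
    proof -
      have y0: "y $ j = 0" if "j < n" "k < j" for j
        using Suc.prems(3) that unfolding y_def by simp
      have "(T *\<^sub>v y) $ i = (\<Sum>j = 0..<n. T $$ (i,j) * y $ j)"
        using T y i by (simp add: scalar_prod_def)
      \<comment> \<open>Triangularity kills the columns \<open>j < i\<close>, and the support of
        \<open>y\<close> kills \<open>j > i\<close> because \<open>i \<ge> k\<close>. The surviving
        diagonal term equals \<open>\<mu> * y $ i\<close>: either \<open>i = k\<close>, or
        \<open>y $ i\<close> is zero.\<close>
      also have "\<dots> = (\<Sum>j = 0..<n. if j = i then T $$ (i,i) * y $ i else 0)"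
      proof (rule sum.cong)
        fix j assume "j \<in> {0..<n}"
        then show "T $$ (i,j) * y $ j = (if j = i then T $$ (i,i) * y $ i else 0)"
          using upper_triangularD[OF tri, of j i] T i y0[of j]
          by (cases j i rule: linorder_cases) auto
      qed simp
      also have "\<dots> = T $$ (i,i) * y $ i" using i by simp
      also have "\<dots> = \<mu> * y $ i" using i y0[of i] unfolding \<mu>_def by (cases "i = k") auto
      finally show ?thesis using T y i by simp
    qed
    then have "P (B *\<^sub>v x - \<mu> \<cdot>\<^sub>v x)"
      using Suc.prems \<mu> by (intro Suc.IH step) (auto simp: Vx')
    then show ?case using pull Suc.prems \<mu> by blast
  qed
  from this[of n w] show ?thesis using \<open>w \<in> S\<close> by simp
qed

section \<open>The homogeneous Stein equation\<close>

lemma eigenvalue_transpose_mat: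
  fixes A :: "'a :: field mat"
  assumes A: "A \<in> carrier_mat n n"
  shows "eigenvalue (transpose_mat A) k \<longleftrightarrow> eigenvalue A k"
  using A by (simp add: eigenvalue_root_char_poly[of _ n])

lemma smult_vec_eq_0_imp:
  fixes v :: "'a :: field vec"
  assumes "k \<cdot>\<^sub>v v = 0\<^sub>v n" "k \<noteq> 0"
  shows "v = 0\<^sub>v n"
proof (rule eq_vecI)
  have d: "dim_vec v = n" using arg_cong[OF assms(1), of dim_vec] by simp
  then show "dim_vec v = dim_vec (0\<^sub>v n :: 'a vec)" by simp
  fix i assume "i < dim_vec (0\<^sub>v n :: 'a vec)"
  then show "v $ i = 0\<^sub>v n $ i" using arg_cong[OF assms(1), of "\<lambda>u. u $ i"] d assms(2) by simp
qed

lemma minus_vec_eq_0_iff: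
  fixes v w :: "'a :: ring vec"
  assumes "v \<in> carrier_vec n" "w \<in> carrier_vec n"
  shows "v - w = 0\<^sub>v n \<longleftrightarrow> v = w"
  using assms by (auto simp: vec_eq_iff)

text \<open>The equation is demanded only on \<open>S\<close>, so that one argument serves twice:
  with \<open>S\<close> the whole space for the symmetry of the solution, and with \<open>S\<close>
  the complexified unobservable subspace, where the term in \<open>Q\<close> vanishes.\<close>

lemma stein_homogeneous_zero_on:
  fixes A Y :: "complex mat"
  assumes A: "A \<in> carrier_mat n n" and Y: "Y \<in> carrier_mat n n"
    and unmixed: "\<And>\<mu> \<nu>. eigenvalue A \<mu> \<Longrightarrow> eigenvalue A \<nu> \<Longrightarrow> \<mu> * \<nu> \<noteq> 1"
    and S: "S \<subseteq> carrier_vec n"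
    and step: "\<And>w \<mu>. w \<in> S \<Longrightarrow> A *\<^sub>v w - \<mu> \<cdot>\<^sub>v w \<in> S"
    and eq: "\<And>w. w \<in> S \<Longrightarrow> Y *\<^sub>v w = transpose_mat A *\<^sub>v (Y *\<^sub>v (A *\<^sub>v w))"
    and "w \<in> S"
  shows "Y *\<^sub>v w = 0\<^sub>v n"
  using A S \<open>w \<in> S\<close>
proof (induction w rule: eigenvalue_chain_induct)
  case (step w \<mu>)
  then show ?case using assms(5) by blast
next
  case zero
  show ?case using Y by (rule mult_mat_zero_vec)
next
  case (pull w \<mu>)
  have w: "w \<in> carrier_vec n" using pull S by auto
  define u where "u = Y *\<^sub>v w"
  have u: "u \<in> carrier_vec n" using Y w unfolding u_def by simp
  have YA: "Y *\<^sub>v (A *\<^sub>v w) = \<mu> \<cdot>\<^sub>v u"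
    using pull(3) A Y w unfolding u_def
    by (simp add: mult_minus_distrib_mat_vec[of _ n n] mult_mat_vec[of _ n n]
        minus_vec_eq_0_iff[of _ n])
  have "u = transpose_mat A *\<^sub>v (Y *\<^sub>v (A *\<^sub>v w))"
    using eq[OF pull(1)] unfolding u_def .
  then have ueq: "u = \<mu> \<cdot>\<^sub>v (transpose_mat A *\<^sub>v u)"
    unfolding YA using u A by (simp add: mult_mat_vec[of _ n n])
  show ?case
  proof (rule ccontr)
    assume "Y *\<^sub>v w \<noteq> 0\<^sub>v n"
    then have u0: "u \<noteq> 0\<^sub>v n" unfolding u_def .
    have \<mu>0: "\<mu> \<noteq> 0"
    proof
      assume "\<mu> = 0"
      then have "u = 0\<^sub>v n" using A u ueq by (auto simp: vec_eq_iff)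
      with u0 show False by simp
    qed
    have "transpose_mat A *\<^sub>v u = (1/\<mu> * \<mu>) \<cdot>\<^sub>v (transpose_mat A *\<^sub>v u)"
      using \<mu>0 by simp
    also have "\<dots> = 1/\<mu> \<cdot>\<^sub>v u"
      by (subst (2) ueq) (rule smult_smult_assoc[symmetric])
    finally have "eigenvalue (transpose_mat A) (1/\<mu>)"
      unfolding eigenvalue_def eigenvector_def using u u0 A by auto
    then have "eigenvalue A (1/\<mu>)" using eigenvalue_transpose_mat[OF A] by simp
    from unmixed[OF pull(2) this] show False using \<mu>0 by simp
  qed
qed

section \<open>Zeros of a semidefinite form\<close>

text \<open>Moving from \<open>w\<close> to \<open>w + t u\<close> with \<open>u = Q w\<close>, the
  form becomes \<open>2 t (u \<bullet> u) + t\<^sup>2 c\<close>. Nonnegativity for all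
  \<open>t\<close> forces the linear coefficient, hence \<open>u\<close>, to vanish.\<close>

lemma psd_quadratic_form_zero:
  assumes Q: "Q \<in> carrier_mat n n" and psd: "psd_mat Q"
    and w: "w \<in> carrier_vec n" and 0: "w \<bullet> (Q *\<^sub>v w) = 0"
  shows "Q *\<^sub>v w = 0\<^sub>v n"
proof -
  define u where "u = Q *\<^sub>v w"
  have u: "u \<in> carrier_vec n" and Qu: "Q *\<^sub>v u \<in> carrier_vec n"
    using Q w unfolding u_def by auto
  have sym: "transpose_mat Q = Q" using psd unfolding psd_mat_def by simp
  have wQu: "w \<bullet> (Q *\<^sub>v u) = u \<bullet> u"
    using transpose_vec_mult_scalar[OF Q u w] sym unfolding u_def by simp
  define a c where "a = u \<bullet> u" and "c = u \<bullet> (Q *\<^sub>v u)"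
  have ineq: "0 \<le> 2 * t * a + t\<^sup>2 * c" for t
  proof -
    have "0 \<le> (w + t \<cdot>\<^sub>v u) \<bullet> (Q *\<^sub>v (w + t \<cdot>\<^sub>v u))"
      using psd Q w u unfolding psd_mat_def by simp
    also have "Q *\<^sub>v (w + t \<cdot>\<^sub>v u) = u + t \<cdot>\<^sub>v (Q *\<^sub>v u)"
      using Q w u by (simp add: mult_add_distrib_mat_vec[of _ n n] mult_mat_vec[of _ n n] u_def)
    also have "(w + t \<cdot>\<^sub>v u) \<bullet> (u + t \<cdot>\<^sub>v (Q *\<^sub>v u)) = 2 * t * a + t\<^sup>2 * c"
      using w u Qu 0 wQu
      by (simp add: scalar_prod_add_distrib[of _ n] add_scalar_prod_distrib[of _ n]
          a_def c_def power2_eq_square algebra_simps flip: u_def)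
    finally show ?thesis .
  qed
  have a0: "a = 0"
  proof (rule ccontr)
    assume "a \<noteq> 0"
    moreover have "0 \<le> a" unfolding a_def scalar_prod_def by (simp add: sum_nonneg)
    ultimately have a: "0 < a" by simp
    \<comment> \<open>Any \<open>d\<close> that is positive and exceeds \<open>c\<close> would do:
      at \<open>t = - a / d\<close> the form, multiplied by \<open>d\<^sup>2\<close>, is
      \<open>a\<^sup>2 * (c - 2 * d)\<close>, which is negative.\<close>
    define d where "d = \<bar>c\<bar> + 1"
    have d: "d > 0" "c < d" unfolding d_def by auto
    have "0 \<le> d\<^sup>2 * (2 * (- a / d) * a + (- a / d)\<^sup>2 * c)"
      using ineq[of "- a / d"] by (intro mult_nonneg_nonneg) auto
    also have "\<dots> = a\<^sup>2 * (c - 2 * d)"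
      using d by (simp add: field_simps power2_eq_square)
    also have "\<dots> < 0" using a d by (intro mult_pos_neg) auto
    finally show False by simp
  qed
  have "u $ i = 0" if "i < n" for i
  proof -
    have "(\<Sum>i = 0..<n. u $ i * u $ i) = 0" using a0 u unfolding a_def scalar_prod_def by simp
    then have "\<forall>i\<in>{0..<n}. u $ i * u $ i = 0" by (subst (asm) sum_nonneg_eq_0_iff) auto
    then show ?thesis using that by simp
  qed
  then show ?thesis using u unfolding u_def[symmetric] by auto
qed

section \<open>Passage from real to complex matrices\<close>

abbreviation cmat :: "real mat \<Rightarrow> complex mat" where
  "cmat \<equiv> map_mat complex_of_real"

abbreviation cvec :: "real vec \<Rightarrow> complex vec" where
  "cvec \<equiv> map_vec complex_of_real"

lemma Re_Im_cmat_mult_vec: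
  assumes "M \<in> carrier_mat m n" "w \<in> carrier_vec n"
  shows "map_vec Re (cmat M *\<^sub>v w) = M *\<^sub>v map_vec Re w"
    and "map_vec Im (cmat M *\<^sub>v w) = M *\<^sub>v map_vec Im w"
  using assms by (auto simp: vec_eq_iff scalar_prod_def)

text \<open>The kernel of a complexified real matrix is the complexification of its real kernel;
  this carries facts about real kernels to the field where eigenvalue chains exist.\<close>

lemma cmat_mult_vec_eq_0_iff:
  assumes M: "M \<in> carrier_mat m n" and w: "w \<in> carrier_vec n"
  shows "cmat M *\<^sub>v w = 0\<^sub>v m \<longleftrightarrow> M *\<^sub>v map_vec Re w = 0\<^sub>v m \<and> M *\<^sub>v map_vec Im w = 0\<^sub>v m"
proof -
  have "x = 0\<^sub>v m \<longleftrightarrow> map_vec Re x = 0\<^sub>v m \<and> map_vec Im x = 0\<^sub>v m"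
    if "x \<in> carrier_vec m" for x
    using that by (auto simp: vec_eq_iff complex_eq_iff)
  from this[of "cmat M *\<^sub>v w"] show ?thesis
    using M w by (simp add: Re_Im_cmat_mult_vec[OF M w])
qed

lemma cmat_mult_cvec_eq_0_iff:
  assumes "M \<in> carrier_mat m n" "v \<in> carrier_vec n"
  shows "cmat M *\<^sub>v cvec v = 0\<^sub>v m \<longleftrightarrow> M *\<^sub>v v = 0\<^sub>v m"
  using assms by (simp flip: of_real_hom.mult_mat_vec_hom)

lemma cmat_transpose: "cmat (transpose_mat A) = transpose_mat (cmat A)"
  by auto

lemma unmixedD:
  assumes "unmixed A" "eigenvalue (cmat A) \<mu>" "eigenvalue (cmat A) \<nu>"
  shows "\<mu> * \<nu> \<noteq> 1"
  using assms unfolding unmixed_def spectrum_def by auto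

section \<open>Symmetry of the solution\<close>

text \<open>As \<open>Q\<close> is symmetric, the transpose of \<open>X\<close> solves the same
  equation. The difference solves the homogeneous one, so it vanishes for unmixed
  \<open>A\<close>.\<close>

lemma stein_solution_symmetric:
  assumes A: "A \<in> carrier_mat n n" and Q: "Q \<in> carrier_mat n n"
    and sym: "transpose_mat Q = Q" and un: "unmixed A" and X: "X \<in> carrier_mat n n"
    and eq: "X = transpose_mat A * X * A + Q"
  shows "transpose_mat X = X"
proof -
  let ?At = "transpose_mat A" and ?Xt = "transpose_mat X"
  have "?Xt = transpose_mat (?At * X * A) + transpose_mat Q"
    by (subst eq) (rule transpose_add[of _ n n], use A X Q in auto)
  also have "transpose_mat (?At * X * A) = ?At * ?Xt * A"
    using A X by (simp add: transpose_mult[of _ n n _ n] assoc_mult_mat[of _ n n _ n _ n])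
  finally have eqt: "?Xt = ?At * ?Xt * A + Q" unfolding sym .
  define Y where "Y = X - ?Xt"
  have Y: "Y \<in> carrier_mat n n" using X unfolding Y_def by (intro minus_carrier_mat) simp
  have "Y = ?At * X * A + Q - (?At * ?Xt * A + Q)"
    unfolding Y_def using eq eqt by simp
  also have "\<dots> = ?At * X * A - ?At * ?Xt * A"
    using A X Q by (intro eq_matI) auto
  also have "\<dots> = ?At * Y * A"
    using A X unfolding Y_def
    by (simp add: mult_minus_distrib_mat[of _ n n _ n] minus_mult_distrib_mat[of _ n n _ _ n])
  finally have Yeq: "Y = ?At * Y * A" .
  have "cmat Y *\<^sub>v w = 0\<^sub>v n" if w: "w \<in> carrier_vec n" for w
  proof (rule stein_homogeneous_zero_on[of "cmat A" n "cmat Y" "carrier_vec n"])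
    fix w :: "complex vec" assume w: "w \<in> carrier_vec n"
    have "cmat Y = cmat ?At * cmat Y * cmat A"
      by (subst Yeq) (use A Y in \<open>simp add: of_real_hom.mat_hom_mult[of _ n n _ n]\<close>)
    then have "cmat Y *\<^sub>v w = (cmat ?At * cmat Y * cmat A) *\<^sub>v w" by simp
    then show "cmat Y *\<^sub>v w = transpose_mat (cmat A) *\<^sub>v (cmat Y *\<^sub>v (cmat A *\<^sub>v w))"
      using A Y w by (simp add: cmat_transpose assoc_mult_mat_vec[of _ n n _ n])
  qed (use A Y w unmixedD[OF un] in auto)
  then have Yv: "Y *\<^sub>v v = 0\<^sub>v n" if "v \<in> carrier_vec n" for v
    using that cmat_mult_cvec_eq_0_iff[OF Y, of v] by simp
  have "Y = 0\<^sub>m n n"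
  proof (rule eq_matI)
    fix i j assume "i < dim_row (0\<^sub>m n n :: real mat)" "j < dim_col (0\<^sub>m n n :: real mat)"
    then show "Y $$ (i,j) = 0\<^sub>m n n $$ (i,j)"
      using arg_cong[OF Yv[of "unit_vec n j"], of "\<lambda>v. v $ i"] Y
      by simp
  qed (use Y in auto)
  then have "\<forall>i<n. \<forall>j<n. (X - ?Xt) $$ (i,j) = 0" unfolding Y_def by simp
  then show ?thesis using X by (intro eq_matI) auto
qed

section \<open>Invertible shifts and invariant kernels\<close>

lemma plus_one_kernel_trivial:
  assumes B: "B \<in> carrier_mat n n" and un: "\<not> eigenvalue (cmat B) (- 1)"
    and u: "u \<in> carrier_vec n" and eq: "(B + 1\<^sub>m n) *\<^sub>v u = 0\<^sub>v n"
  shows "u = 0\<^sub>v n"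
proof (rule ccontr)
  assume "u \<noteq> 0\<^sub>v n"
  then have u0: "cvec u \<noteq> 0\<^sub>v n" by simp
  have "B *\<^sub>v u + u = 0\<^sub>v n"
    using eq B u by (simp add: add_mult_distrib_mat_vec[of _ n n])
  then have *: "\<forall>i<n. (B *\<^sub>v u) $ i + u $ i = 0"
    using B u by (metis carrier_matD(1) carrier_vecD index_add_vec(1) index_zero_vec(1))
  have "B *\<^sub>v u = (-1) \<cdot>\<^sub>v u"
    using B u * by (intro eq_vecI) (auto simp: eq_neg_iff_add_eq_0)
  then have "cmat B *\<^sub>v cvec u = (-1) \<cdot>\<^sub>v cvec u"
    using B u by (simp add: of_real_hom.vec_hom_smult flip: of_real_hom.mult_mat_vec_hom)
  then have "eigenvector (cmat B) (cvec u) (- 1)"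
    using u u0 B unfolding eigenvector_def by (metis carrier_matD(1) map_carrier_mat map_carrier_vec)
  then show False using un unfolding eigenvalue_def by blast
qed

lemma mat_right_inverse_exists:
  fixes M :: "'a :: field mat"
  assumes M: "M \<in> carrier_mat n n"
    and inj: "\<And>v. v \<in> carrier_vec n \<Longrightarrow> M *\<^sub>v v = 0\<^sub>v n \<Longrightarrow> v = 0\<^sub>v n"
  obtains R where "R \<in> carrier_mat n n" "M * R = 1\<^sub>m n"
proof -
  have "det M \<noteq> 0" using det_0_iff_vec_prod_zero_field[OF M] inj by auto
  from det_non_zero_imp_unit[OF M this, of "()"] that show thesis
    unfolding Units_def ring_mat_def by auto
qed

text \<open>Chain induction for \<open>R\<close> takes the place of a dimension count. Since
  \<open>M R = 1\<close> and \<open>X w = 0\<close>, applying \<open>X M\<close> to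
  \<open>R w - \<mu> w\<close> gives \<open>- \<mu> X M w\<close>, and \<open>\<mu>\<close> is
  nonzero because \<open>R\<close> is injective.\<close>

lemma kernel_invariant_inverse:
  fixes X M R :: "real mat"
  assumes X: "X \<in> carrier_mat n n" and M: "M \<in> carrier_mat n n" and R: "R \<in> carrier_mat n n"
    and MR: "M * R = 1\<^sub>m n"
    and inv: "\<And>v. v \<in> carrier_vec n \<Longrightarrow> X *\<^sub>v v = 0\<^sub>v n \<Longrightarrow> X *\<^sub>v (R *\<^sub>v v) = 0\<^sub>v n"
    and v: "v \<in> carrier_vec n" and Xv: "X *\<^sub>v v = 0\<^sub>v n"
  shows "X *\<^sub>v (M *\<^sub>v v) = 0\<^sub>v n"
proof -
  define S where "S = {w \<in> carrier_vec n. cmat X *\<^sub>v w = 0\<^sub>v n}"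
  have cX: "cmat X \<in> carrier_mat n n" and cM: "cmat M \<in> carrier_mat n n"
    and cR: "cmat R \<in> carrier_mat n n" using X M R by auto
  have S: "S \<subseteq> carrier_vec n" unfolding S_def by auto
  have cMR: "cmat M *\<^sub>v (cmat R *\<^sub>v w) = w"
    if w: "w \<in> carrier_vec n" for w
  proof -
    have "cmat M * cmat R = 1\<^sub>m n"
      using MR M R by (simp add: of_real_hom.mat_hom_one flip: of_real_hom.mat_hom_mult)
    then show "cmat M *\<^sub>v (cmat R *\<^sub>v w) = w"
      using w cM cR by (simp flip: assoc_mult_mat_vec)
  qed
  \<comment> \<open>The real hypothesis is applied to the real and imaginary parts
    separately.\<close>
  have cinv: "cmat X *\<^sub>v (cmat R *\<^sub>v w) = 0\<^sub>v n" if "w \<in> S" for w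
  proof -
    have w: "w \<in> carrier_vec n" "cmat X *\<^sub>v w = 0\<^sub>v n" using that unfolding S_def by auto
    then have "X *\<^sub>v (R *\<^sub>v map_vec Re w) = 0\<^sub>v n" "X *\<^sub>v (R *\<^sub>v map_vec Im w) = 0\<^sub>v n"
      using cmat_mult_vec_eq_0_iff[OF X w(1)] inv by simp_all
    then show ?thesis
      using cmat_mult_vec_eq_0_iff[OF X mult_mat_vec_carrier[OF cR w(1)]]
      by (simp add: Re_Im_cmat_mult_vec[OF R w(1)])
  qed
  have mem: "cvec v \<in> S"
    using v Xv cmat_mult_cvec_eq_0_iff[OF X v] unfolding S_def by simp
  have "cmat X *\<^sub>v (cmat M *\<^sub>v w) = 0\<^sub>v n" if "w \<in> S" for w
    using cR S that
  proof (induction w rule: eigenvalue_chain_induct)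
    case (step w \<mu>)
    then show ?case using cinv[of w] cX cR S unfolding S_def
      by (auto simp: mult_minus_distrib_mat_vec[of _ n n] mult_mat_vec[of _ n n])
  next
    case zero
    show ?case using mult_mat_zero_vec[OF cM] mult_mat_zero_vec[OF cX] by simp
  next
    case (pull w \<mu>)
    have w: "w \<in> carrier_vec n" "cmat X *\<^sub>v w = 0\<^sub>v n" using pull(1) unfolding S_def by auto
    have \<mu>0: "\<mu> \<noteq> 0"
    proof
      assume "\<mu> = 0"
      then obtain x where x: "x \<in> carrier_vec n" "x \<noteq> 0\<^sub>v n" and "cmat R *\<^sub>v x = 0 \<cdot>\<^sub>v x"
        using pull(2) cR unfolding eigenvalue_def eigenvector_def by auto
      then have "cmat R *\<^sub>v x = 0\<^sub>v n" by (auto simp: vec_eq_iff)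
      then have "x = 0\<^sub>v n" using cMR[OF x(1)] mult_mat_zero_vec[OF cM] by simp
      with x show False by simp
    qed
    have "0\<^sub>v n - \<mu> \<cdot>\<^sub>v (cmat X *\<^sub>v (cmat M *\<^sub>v w)) = 0\<^sub>v n"
      using pull(3) w cX cM cR
      by (simp add: mult_minus_distrib_mat_vec[of _ n n] mult_mat_vec[of _ n n] cMR)
    then have "\<mu> \<cdot>\<^sub>v (cmat X *\<^sub>v (cmat M *\<^sub>v w)) = 0\<^sub>v n"
      by (subst (asm) minus_vec_eq_0_iff[of _ n]) (use w cX cM in auto)
    then show ?case using smult_vec_eq_0_imp \<mu>0 by blast
  qed
  from this[OF mem] have "cmat X *\<^sub>v cvec (M *\<^sub>v v) = 0\<^sub>v n"
    using M v by (simp add: of_real_hom.mult_mat_vec_hom)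
  then show ?thesis using cmat_mult_cvec_eq_0_iff[OF X] M v by simp
qed

section \<open>From the unobservable subspace to the kernel\<close>

lemma mult_pow_Suc_mat_vec:
  assumes "Q \<in> carrier_mat m n" "A \<in> carrier_mat n n" "v \<in> carrier_vec n"
  shows "(Q * A ^\<^sub>m Suc k) *\<^sub>v v = (Q * A ^\<^sub>m k) *\<^sub>v (A *\<^sub>v v)"
proof -
  have "Q * A ^\<^sub>m Suc k = (Q * A ^\<^sub>m k) * A"
    using assms by (simp add: assoc_mult_mat[of _ m n _ n _ n])
  then show ?thesis
    using assms by (simp add: assoc_mult_mat_vec[of "Q * A ^\<^sub>m k" m n A n] del: pow_mat.simps)
qed

lemma unobservable_subspace_eq:
  assumes "A \<in> carrier_mat n n" "Q \<in> carrier_mat m n"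
  shows "unobservable_subspace A Q =
    {v \<in> carrier_vec n. \<forall>k. (Q * A ^\<^sub>m k) *\<^sub>v v = 0\<^sub>v m}"
  using assms mat_kernel[of "Q * A ^\<^sub>m _" m n] unfolding unobservable_subspace_def by auto

lemma stein_apply:
  fixes A Q X :: "'a :: comm_ring_1 mat"
  assumes A: "A \<in> carrier_mat n n" and Q: "Q \<in> carrier_mat n n" and X: "X \<in> carrier_mat n n"
    and eq: "X = transpose_mat A * X * A + Q" and v: "v \<in> carrier_vec n"
  shows "X *\<^sub>v v = transpose_mat A *\<^sub>v (X *\<^sub>v (A *\<^sub>v v)) + Q *\<^sub>v v"
proof -
  have "X *\<^sub>v v = (transpose_mat A * X * A + Q) *\<^sub>v v" using eq by simp
  then show ?thesis
    using A Q X v by (simp add: add_mult_distrib_mat_vec[of _ n n] assoc_mult_mat_vec[of _ n n _ n])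
qed

text \<open>On the complexified unobservable subspace the exponent \<open>0\<close> gives
  \<open>Q w = 0\<close>, so the Stein equation becomes homogeneous there and its only solution on
  that subspace is zero.\<close>

lemma unobservable_subset_kernel:
  assumes A: "A \<in> carrier_mat n n" and Q: "Q \<in> carrier_mat n n" and un: "unmixed A"
    and X: "X \<in> carrier_mat n n" and eq: "X = transpose_mat A * X * A + Q"
  shows "unobservable_subspace A Q \<subseteq> mat_kernel X"
proof
  fix v assume "v \<in> unobservable_subspace A Q"
  then have v: "v \<in> carrier_vec n" and ker: "\<And>k. (Q * A ^\<^sub>m k) *\<^sub>v v = 0\<^sub>v n"
    using unobservable_subspace_eq[OF A Q] by auto
  have cA: "cmat A \<in> carrier_mat n n" and cQ: "cmat Q \<in> carrier_mat n n"
    and cX: "cmat X \<in> carrier_mat n n" using A Q X by auto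
  have cQA: "cmat Q * cmat A ^\<^sub>m k \<in> carrier_mat n n" for k using cQ cA by simp
  define S where "S = {w \<in> carrier_vec n. \<forall>k. (cmat Q * cmat A ^\<^sub>m k) *\<^sub>v w = 0\<^sub>v n}"
  have hom: "cmat (Q * A ^\<^sub>m k) = cmat Q * cmat A ^\<^sub>m k" for k
    using A Q by (simp add: of_real_hom.mat_hom_mult[of _ n n _ n] of_real_hom.mat_hom_pow[of _ n])
  have mem: "cvec v \<in> S"
    using v ker cmat_mult_cvec_eq_0_iff[of "Q * A ^\<^sub>m _" n n v] A Q unfolding S_def
    by (auto simp flip: hom)
  have add: "cmat (B + C) = cmat B + cmat C" if "B \<in> carrier_mat n n" "C \<in> carrier_mat n n" for B C
    using that by auto
  have ceq: "cmat X = transpose_mat (cmat A) * cmat X * cmat A + cmat Q"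
    by (subst eq) (use A Q X in
      \<open>simp add: add of_real_hom.mat_hom_mult[of _ n n _ n] cmat_transpose\<close>)
  have "cmat X *\<^sub>v cvec v = 0\<^sub>v n"
  proof (rule stein_homogeneous_zero_on[OF cA cX, of S])
    show "\<mu> * \<nu> \<noteq> 1" if "eigenvalue (cmat A) \<mu>" "eigenvalue (cmat A) \<nu>" for \<mu> \<nu>
      using unmixedD[OF un] that by blast
    show "S \<subseteq> carrier_vec n" "cvec v \<in> S" using mem unfolding S_def by auto
  next
    fix w \<mu> assume "w \<in> S"
    then have w: "w \<in> carrier_vec n" "\<And>k. (cmat Q * cmat A ^\<^sub>m k) *\<^sub>v w = 0\<^sub>v n"
      unfolding S_def by auto
    \<comment> \<open>The condition on \<open>A w\<close> at exponent \<open>k\<close> is the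
      condition on \<open>w\<close> at exponent \<open>k + 1\<close>.\<close>
    have "(cmat Q * cmat A ^\<^sub>m k) *\<^sub>v (cmat A *\<^sub>v w - \<mu> \<cdot>\<^sub>v w) = 0\<^sub>v n" for k
    proof -
      have "(cmat Q * cmat A ^\<^sub>m k) *\<^sub>v (cmat A *\<^sub>v w - \<mu> \<cdot>\<^sub>v w) =
          (cmat Q * cmat A ^\<^sub>m k) *\<^sub>v (cmat A *\<^sub>v w) - (cmat Q * cmat A ^\<^sub>m k) *\<^sub>v (\<mu> \<cdot>\<^sub>v w)"
        using cA w(1) by (intro mult_minus_distrib_mat_vec[OF cQA]) auto
      also have "\<dots> = 0\<^sub>v n - \<mu> \<cdot>\<^sub>v 0\<^sub>v n"
        by (simp only: mult_pow_Suc_mat_vec[OF cQ cA w(1), symmetric] mult_mat_vec[OF cQA w(1)] w(2))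
      also have "\<dots> = 0\<^sub>v n" by (intro eq_vecI) auto
      finally show ?thesis .
    qed
    then show "cmat A *\<^sub>v w - \<mu> \<cdot>\<^sub>v w \<in> S" using w cA unfolding S_def by simp
  next
    fix w assume "w \<in> S"
    then have w: "w \<in> carrier_vec n" and "(cmat Q * cmat A ^\<^sub>m 0) *\<^sub>v w = 0\<^sub>v n"
      unfolding S_def by blast+
    then have "cmat Q *\<^sub>v w = 0\<^sub>v n" using cQ cA by simp
    then show "cmat X *\<^sub>v w = transpose_mat (cmat A) *\<^sub>v (cmat X *\<^sub>v (cmat A *\<^sub>v w))"
      using stein_apply[OF cA cQ cX ceq w] cA cX w by simp
  qed
  then show "v \<in> mat_kernel X"
    using v X cmat_mult_cvec_eq_0_iff[OF X v] by (intro mat_kernelI) auto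
qed

section \<open>From the kernel to the unobservable subspace\<close>

text \<open>Stating this for \<open>w\<close> rather than for \<open>v = (A + I) w\<close> avoids
  the inverse and allows two uses: with \<open>w\<close> in the image of the inverse, and later with
  \<open>w\<close> itself in \<open>ker X\<close>.\<close>

lemma cayley_resolvent_kernel:
  assumes A: "A \<in> carrier_mat n n" and Q: "Q \<in> carrier_mat n n" and psd: "psd_mat Q"
    and un: "unmixed A" and X: "X \<in> carrier_mat n n"
    and eq: "X = transpose_mat A * X * A + Q"
    and w: "w \<in> carrier_vec n" and ker: "X *\<^sub>v ((A + 1\<^sub>m n) *\<^sub>v w) = 0\<^sub>v n"
  shows "X *\<^sub>v w = 0\<^sub>v n" and "Q *\<^sub>v w = 0\<^sub>v n"
proof -
  let ?At = "transpose_mat A"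
  have At: "?At \<in> carrier_mat n n" using A by simp
  have "transpose_mat Q = Q" using psd unfolding psd_mat_def by simp
  from stein_solution_symmetric[OF A Q this un X eq] have sym: "transpose_mat X = X" .
  define y where "y = A *\<^sub>v w"
  have y: "y \<in> carrier_vec n" and Xw: "X *\<^sub>v w \<in> carrier_vec n" and Xy: "X *\<^sub>v y \<in> carrier_vec n"
    and Qw: "Q *\<^sub>v w \<in> carrier_vec n"
    using A Q X w unfolding y_def by auto
  have "X *\<^sub>v y + X *\<^sub>v w = 0\<^sub>v n"
    using ker A X w y
    by (simp add: add_mult_distrib_mat_vec[of _ n n] mult_add_distrib_mat_vec[of _ n n] flip: y_def)
  then have "(X *\<^sub>v y) $ i + (X *\<^sub>v w) $ i = 0" if "i < n" for i
    using that X by (metis carrier_matD(1) dim_mult_mat_vec index_add_vec(1) index_zero_vec(1))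
  then have Xyw: "X *\<^sub>v y = - (X *\<^sub>v w)"
    using X by (intro eq_vecI) (auto simp: eq_neg_iff_add_eq_0)
  have wXy: "w \<bullet> (X *\<^sub>v y) = y \<bullet> (X *\<^sub>v w)"
    using transpose_vec_mult_scalar[OF X y w] comm_scalar_prod[OF Xw y] sym by simp
  have "w \<bullet> (X *\<^sub>v w) = w \<bullet> (?At *\<^sub>v (X *\<^sub>v y)) + w \<bullet> (Q *\<^sub>v w)"
    using stein_apply[OF A Q X eq w] scalar_prod_add_distrib[OF w _ Qw] At Xy
    unfolding y_def[symmetric] by simp
  also have "w \<bullet> (?At *\<^sub>v (X *\<^sub>v y)) = y \<bullet> (X *\<^sub>v y)"
    using transpose_vec_mult_scalar[OF A w Xy] comm_scalar_prod[of w n "?At *\<^sub>v (X *\<^sub>v y)"]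
      comm_scalar_prod[OF y Xy] At w Xy unfolding y_def by simp
  \<comment> \<open>The relation \<open>X y = - X w\<close> enters twice, with \<open>wXy\<close> in
    between; the signs cancel and \<open>w \<bullet> (X *\<^sub>v w)\<close> reappears.\<close>
  also have "\<dots> = - (y \<bullet> (X *\<^sub>v w))" unfolding Xyw using y Xw by (simp add: scalar_prod_def sum_negf)
  also have "\<dots> = - (w \<bullet> (X *\<^sub>v y))" unfolding wXy ..
  also have "\<dots> = w \<bullet> (X *\<^sub>v w)" unfolding Xyw using w Xw by (simp add: scalar_prod_def sum_negf)
  finally have "w \<bullet> (Q *\<^sub>v w) = 0" by simp
  from psd_quadratic_form_zero[OF Q psd w this] show Qw0: "Q *\<^sub>v w = 0\<^sub>v n" .
  have "X *\<^sub>v w = ?At *\<^sub>v (X *\<^sub>v y)"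
    using stein_apply[OF A Q X eq w] Qw0 At Xy unfolding y_def[symmetric] by simp
  also have "\<dots> = - (?At *\<^sub>v (X *\<^sub>v w))"
    unfolding Xyw using A Xw by (intro eq_vecI) (auto simp: scalar_prod_def sum_negf)
  finally have "(?At + 1\<^sub>m n) *\<^sub>v (X *\<^sub>v w) = ?At *\<^sub>v (X *\<^sub>v w) + - (?At *\<^sub>v (X *\<^sub>v w))"
    using At Xw by (simp add: add_mult_distrib_mat_vec[of _ n n])
  also have "\<dots> = 0\<^sub>v n" using At Xw by (intro eq_vecI) auto
  finally have *: "(?At + 1\<^sub>m n) *\<^sub>v (X *\<^sub>v w) = 0\<^sub>v n" .
  \<comment> \<open>Unmixedness is used with both eigenvalues equal to \<open>-1\<close>, whose
    square is \<open>1\<close>.\<close>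
  have "\<not> eigenvalue (cmat ?At) (- 1)"
    using unmixedD[OF un, of "-1" "-1"] A by (auto simp: cmat_transpose eigenvalue_transpose_mat[of _ n])
  from plus_one_kernel_trivial[OF At this Xw *] show "X *\<^sub>v w = 0\<^sub>v n" .
qed

lemma kernel_subset_unobservable:
  assumes A: "A \<in> carrier_mat n n" and Q: "Q \<in> carrier_mat n n" and psd: "psd_mat Q"
    and un: "unmixed A" and X: "X \<in> carrier_mat n n"
    and eq: "X = transpose_mat A * X * A + Q"
  shows "mat_kernel X \<subseteq> unobservable_subspace A Q"
proof
  fix v assume "v \<in> mat_kernel X"
  then have v: "v \<in> carrier_vec n" "X *\<^sub>v v = 0\<^sub>v n" using mat_kernelD[OF X] by auto
  define M where "M = A + 1\<^sub>m n"
  have M: "M \<in> carrier_mat n n" using A unfolding M_def by simp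
  have "\<not> eigenvalue (cmat A) (- 1)" using unmixedD[OF un, of "-1" "-1"] by auto
  from mat_right_inverse_exists[OF M] plus_one_kernel_trivial[OF A this] obtain R
    where R: "R \<in> carrier_mat n n" and MR: "M * R = 1\<^sub>m n"
    unfolding M_def by metis
  have XR: "X *\<^sub>v (R *\<^sub>v x) = 0\<^sub>v n" if x: "x \<in> carrier_vec n" "X *\<^sub>v x = 0\<^sub>v n" for x
  proof (rule cayley_resolvent_kernel(1)[OF A Q psd un X eq])
    have "M *\<^sub>v (R *\<^sub>v x) = (M * R) *\<^sub>v x" using M R x by simp
    then show "X *\<^sub>v ((A + 1\<^sub>m n) *\<^sub>v (R *\<^sub>v x)) = 0\<^sub>v n" using MR x unfolding M_def by simp
  qed (use R x in simp)
  have XM: "X *\<^sub>v (M *\<^sub>v x) = 0\<^sub>v n" if x: "x \<in> carrier_vec n" "X *\<^sub>v x = 0\<^sub>v n" for x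
    using kernel_invariant_inverse[OF X M R MR XR x] .
  \<comment> \<open>Here \<open>w\<close> is \<open>x\<close> itself, which is admissible once
    \<open>ker X\<close> is known to be invariant under \<open>M\<close>.\<close>
  have Qx: "Q *\<^sub>v x = 0\<^sub>v n" if x: "x \<in> carrier_vec n" "X *\<^sub>v x = 0\<^sub>v n" for x
    using cayley_resolvent_kernel(2)[OF A Q psd un X eq x(1)] XM[OF x] unfolding M_def by simp
  \<comment> \<open>Invariance passes from \<open>M\<close> to \<open>A\<close> because
    \<open>A x = M x - x\<close>.\<close>
  have XA: "X *\<^sub>v (A *\<^sub>v x) = 0\<^sub>v n" if x: "x \<in> carrier_vec n" "X *\<^sub>v x = 0\<^sub>v n" for x
    using XM[OF x] x A X unfolding M_def
    by (simp add: add_mult_distrib_mat_vec[of _ n n] mult_add_distrib_mat_vec[of _ n n])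
  have "(Q * A ^\<^sub>m k) *\<^sub>v x = 0\<^sub>v n" if "x \<in> carrier_vec n" "X *\<^sub>v x = 0\<^sub>v n" for k x
    using that
  proof (induction k arbitrary: x)
    case 0
    then show ?case using Q A Qx by simp
  next
    case (Suc k)
    then show ?case unfolding mult_pow_Suc_mat_vec[OF Q A Suc.prems(1)]
      using A XA by (intro Suc.IH) auto
  qed
  then show "v \<in> unobservable_subspace A Q" using v unobservable_subspace_eq[OF A Q] by simp
qed

theorem lemma3p2:
  fixes n :: nat and A Q X :: "real mat"
  assumes "A \<in> carrier_mat n n" and "Q \<in> carrier_mat n n"
    and "psd_mat Q"
    and "unmixed A"
    and "X \<in> carrier_mat n n"
    and "X = transpose_mat A * X * A + Q"
  shows "mat_kernel X = unobservable_subspace A Q"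
  using kernel_subset_unobservable[OF assms] unobservable_subset_kernel[OF assms(1,2,4-6)] by blast

end
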